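(* Let $d\ge 1$ and $n$ be such that $2^d+d=n/2$. Then there is a Las Vegas probabilistic OBDD computing $\mathtt{SSA}_n$ with error bound $1/2$ of width at most $2^{2^d/2+d+3}$, i.e. $\mathsf{LV\text{-}OBDD}_{0.5}(\mathtt{SSA}_n)\le 2^{2^d/2+d+3}$.
   Context: Shuffled Storage Access function $\mathtt{SSA}_n:\{0,1\}^n\to\{0,1\}$ ($n$ even, $2^d+d=n/2$): for input $x$, let $I_0=(2i_1<\dots<2i_m)$ be the sorted list of even indices $2i$ with $x_{2i-1}=0$ and $I_1=(2j_1<\dots<2j_k)$ the sorted list of even indices $2i$ with $x_{2i-1}=1$. Let $\mathtt{ShiftX}((a_1,\dots,a_t),b)=(a_2,\dots,a_t,a_1\oplus b)$. Start with $\alpha=0^{2^d}$ and for $r=1,\dots,m$ set $\alpha:=\mathtt{ShiftX}(\alpha,x_{2i_r})$; start with $\beta=0^d$ and for $r=1,\dots,k$ set $\beta:=\mathtt{ShiftX}(\beta,x_{2j_r})$. Then $\mathtt{SSA}_n(x)$ is the bit of $\alpha$ at the address encoded in binary by $\beta$. A probabilistic OBDD of width $m$ over $x_1,\dots,x_n$: a permutation $\pi$ of $\{1,\dots,n\}$, a state set $S$ of size $m$, an initial probability distribution $v_0$ on $S$, and for each step $j$ two $m\times m$ column-stochastic matrices $T_j^0,T_j^1$; the distribution after step $j$ is $v_j=T_j^{x_{\pi(j)}}v_{j-1}$. In a Las Vegas POBDD, $S$ is partitioned into accepting, rejecting and neutral ("don't know") states; it computes $f$ with error bound $\varepsilon$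 if for every input the final distribution gives probability $0$ to states giving the wrong answer and probability at least $1-\varepsilon$ to states giving the correct answer $f(x)$. $\mathsf{LV\text{-}OBDD}_{\varepsilon}(f)$ is the minimum width of such a program. *)

theory Defs
  imports
    "Jordan_Normal_Form.Matrix"
    "HOL-Combinatorics.Permutations"
    "HOL-Library.FuncSet"
    "HOL-Library.Extended_Nat"
begin

text \<open>Inputs in \<open>{0,1}\<^sup>n\<close> are functions on \<open>{1..n}\<close>, with \<open>False\<close> for 0 and \<open>True\<close> for 1.\<close>

definition bit_inputs :: "nat \<Rightarrow> (nat \<Rightarrow> bool) set" where
  "bit_inputs n = {1..n} \<rightarrow>\<^sub>E UNIV"

section \<open>Shuffled Storage Access\<close>

definition ShiftX :: "bool list \<Rightarrow> bool \<Rightarrow> bool list" where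
  "ShiftX a b = tl a @ [hd a \<noteq> b]"

definition marked_indices :: "nat \<Rightarrow> bool \<Rightarrow> (nat \<Rightarrow> bool) \<Rightarrow> nat list" where
  "marked_indices n c x = map (\<lambda>i. 2 * i) (filter (\<lambda>i. x (2 * i - 1) = c) [1..<Suc (n div 2)])"

definition shift_in :: "nat \<Rightarrow> nat list \<Rightarrow> (nat \<Rightarrow> bool) \<Rightarrow> bool list" where
  "shift_in t js x = foldl (\<lambda>a j. ShiftX a (x j)) (replicate t False) js"

text \<open>\<open>horner_sum\<close> reads the least significant bit first, so the reversal makes the first entry
  the most significant bit.\<close>

definition binary_address :: "bool list \<Rightarrow> nat" where
  "binary_address bs = horner_sum of_bool 2 (rev bs)"

text \<open>Used only for even \<open>n\<close> with \<open>2 ^ d + d = n div 2\<close>, which determines \<open>d\<close> from \<open>n\<close>.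
  Addresses count from 0.\<close>

definition SSA :: "nat \<Rightarrow> nat \<Rightarrow> (nat \<Rightarrow> bool) \<Rightarrow> bool" where
  "SSA d n x =
    (let \<alpha> = shift_in (2 ^ d) (marked_indices n False x) x;
         \<beta> = shift_in d (marked_indices n True x) x
     in \<alpha> ! binary_address \<beta>)"

section \<open>Las Vegas probabilistic OBDDs\<close>

definition prob_vec :: "nat \<Rightarrow> real vec \<Rightarrow> bool" where
  "prob_vec m v \<longleftrightarrow> v \<in> carrier_vec m \<and> (\<forall>i<m. 0 \<le> v $ i) \<and> (\<Sum>i<m. v $ i) = 1"

definition column_stochastic :: "nat \<Rightarrow> real mat \<Rightarrow> bool" where
  "column_stochastic m A \<longleftrightarrow> A \<in> carrier_mat m m \<and> (\<forall>k<m. prob_vec m (col A k))"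

text \<open>The state set is \<open>{..<width}\<close>; \<open>transition P j b\<close> is the matrix of step \<open>j\<close>
  (counted from 1) when the bit read is \<open>b\<close>.\<close>

record pobdd =
  width :: nat
  var_order :: "nat \<Rightarrow> nat"
  init_dist :: "real vec"
  transition :: "nat \<Rightarrow> bool \<Rightarrow> real mat"

record lv_pobdd = pobdd +
  accepting :: "nat set"
  rejecting :: "nat set"
  neutral :: "nat set"

definition is_pobdd :: "nat \<Rightarrow> 'a pobdd_scheme \<Rightarrow> bool" where
  "is_pobdd n P \<longleftrightarrow>
    var_order P permutes {1..n} \<and>
    prob_vec (width P) (init_dist P) \<and>
    (\<forall>j\<in>{1..n}. \<forall>b. column_stochastic (width P) (transition P j b))"

definition is_lv_pobdd :: "nat \<Rightarrow> lv_pobdd \<Rightarrow> bool" where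
  "is_lv_pobdd n P \<longleftrightarrow>
    is_pobdd n P \<and>
    accepting P \<union> rejecting P \<union> neutral P = {..<width P} \<and>
    accepting P \<inter> rejecting P = {} \<and>
    accepting P \<inter> neutral P = {} \<and>
    rejecting P \<inter> neutral P = {}"

primrec dist_after :: "'a pobdd_scheme \<Rightarrow> (nat \<Rightarrow> bool) \<Rightarrow> nat \<Rightarrow> real vec" where
  "dist_after P x 0 = init_dist P"
| "dist_after P x (Suc j) = transition P (Suc j) (x (var_order P (Suc j))) *\<^sub>v dist_after P x j"

definition answer_states :: "lv_pobdd \<Rightarrow> bool \<Rightarrow> nat set" where
  "answer_states P b = (if b then accepting P else rejecting P)"

definition lv_computes :: "nat \<Rightarrow> real \<Rightarrow> lv_pobdd \<Rightarrow> ((nat \<Rightarrow> bool) \<Rightarrow> bool) \<Rightarrow> bool" where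
  "lv_computes n \<epsilon> P f \<longleftrightarrow>
    is_lv_pobdd n P \<and>
    (\<forall>x\<in>bit_inputs n.
      (\<Sum>i\<in>answer_states P (\<not> f x). dist_after P x n $ i) = 0 \<and>
      (\<Sum>i\<in>answer_states P (f x). dist_after P x n $ i) \<ge> 1 - \<epsilon>)"

text \<open>Valued in \<open>enat\<close> so that the minimum is \<open>\<infinity>\<close>, not 0, if no program exists.\<close>

definition LV_OBDD :: "nat \<Rightarrow> real \<Rightarrow> ((nat \<Rightarrow> bool) \<Rightarrow> bool) \<Rightarrow> enat" where
  "LV_OBDD n \<epsilon> f = Inf {enat (width P) | P. lv_computes n \<epsilon> P f}"

end

theory Submission
  imports Defs
begin

text \<open>The program reads the variables in their natural order. Each step shifts the storage
  \<open>\<alpha>\<close> by one place, so a class of cells of equal parity stays together and merely changes its parity;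
  such a class is therefore a queue of \<open>2 ^ d div 2\<close> bits which has to be updated only in every second
  step. A fair coin selects one of the two classes at the beginning and everything else is
  deterministic: the state consists of the selected queue, its current parity, the address register
  \<open>\<beta>\<close> and the last selector bit. The program answers iff the final address has the parity of
  its queue, which happens for exactly one of the two outcomes of the coin.\<close>

section \<open>Deterministic transitions with a random initial state\<close>

primrec run :: "(nat \<Rightarrow> bool \<Rightarrow> 's \<Rightarrow> 's) \<Rightarrow> (nat \<Rightarrow> bool) \<Rightarrow> 's \<Rightarrow> nat \<Rightarrow> 's" where
  "run \<delta> x s 0 = s"
| "run \<delta> x s (Suc j) = \<delta> (Suc j) (x (Suc j)) (run \<delta> x s j)"

lemma run_closed:
  assumes "\<And>j b s. s \<in> S \<Longrightarrow> \<delta> j b s \<in> S" and "s \<in> S"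
  shows "run \<delta> x s j \<in> S"
  by (induction j) (use assms in auto)

text \<open>With 0/1 transition matrices the only randomness is the choice of the initial state, so
  every distribution is the image of \<open>p\<close> under \<open>run\<close>. The probability of
  an answer is then the \<open>p\<close>-mass of the initial states whose run ends with it, and no
  matrices remain to be handled.\<close>

lemma lv_computes_of_deterministic_transitions:
  fixes S :: "'s set" and \<delta> :: "nat \<Rightarrow> bool \<Rightarrow> 's \<Rightarrow> 's" and p :: "'s \<Rightarrow> real"
    and out :: "'s \<Rightarrow> bool option"
  assumes fin: "finite S"
    and closed: "\<And>j b s. s \<in> S \<Longrightarrow> \<delta> j b s \<in> S"
    and p_nonneg: "\<And>s. s \<in> S \<Longrightarrow> 0 \<le> p s" and p_sum: "sum p S = 1"
    and wrong: "\<And>x. x \<in> bit_inputs n \<Longrightarrow>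
      (\<Sum>s | s \<in> S \<and> out (run \<delta> x s n) = Some (\<not> f x). p s) = 0"
    and right: "\<And>x. x \<in> bit_inputs n \<Longrightarrow>
      (\<Sum>s | s \<in> S \<and> out (run \<delta> x s n) = Some (f x). p s) \<ge> 1 - \<epsilon>"
  shows "\<exists>P. lv_computes n \<epsilon> P f \<and> width P = card S"
proof -
  define m where "m = card S"
  obtain g where g: "bij_betw g {..<m} S"
    using ex_bij_betw_nat_finite[OF fin] unfolding m_def atLeast0LessThan by blast
  have gS: "g i \<in> S" if "i < m" for i
    using g that by (auto simp: bij_betw_def)
  have g_inj: "g i = g k \<longleftrightarrow> i = k" if "i < m" "k < m" for i k
    using g that by (auto simp: bij_betw_def inj_on_def)
  have reindex: "(\<Sum>i | i < m \<and> Q (g i). h (g i)) = (\<Sum>s | s \<in> S \<and> Q s. h s)"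
    for Q and h :: "'s \<Rightarrow> real"
  proof (rule sum.reindex_bij_betw)
    show "bij_betw g {i. i < m \<and> Q (g i)} {s. s \<in> S \<and> Q s}"
      using g by (auto simp: bij_betw_def inj_on_def)
  qed
  \<comment> \<open>Each column of a transition matrix has exactly one entry 1. This gives
    stochasticity below, and it also collapses the sum over intermediate states in
    \<open>dist\<close>.\<close>
  have indicator_sum: "(\<Sum>i<m. of_bool (g i = s)) = (1::real)" if "s \<in> S" for s
  proof -
    have "s \<in> g ` {..<m}"
      using bij_betw_imp_surj_on[OF g] that by simp
    then obtain i where i: "i < m" "g i = s" by auto
    have "(\<Sum>k<m. of_bool (g k = s)) = (\<Sum>k<m. if k = i then 1 else (0::real))"
      using i g_inj by (intro sum.cong) auto
    also have "\<dots> = 1" using i by simp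
    finally show ?thesis .
  qed
  define P :: lv_pobdd where "P = \<lparr> width = m, var_order = id, init_dist = vec m (\<lambda>i. p (g i)),
      transition = (\<lambda>j b. mat m m (\<lambda>(i, k). of_bool (g i = \<delta> j b (g k)))),
      accepting = {i. i < m \<and> out (g i) = Some True},
      rejecting = {i. i < m \<and> out (g i) = Some False},
      neutral = {i. i < m \<and> out (g i) = None} \<rparr>"
  have P_transition: "transition P j b = mat m m (\<lambda>(i, k). of_bool (g i = \<delta> j b (g k)))" for j b
    by (simp add: P_def)
  have P_order: "var_order P = id"
    by (simp add: P_def)
  have dist: "dist_after P x j \<in> carrier_vec m \<and>
      (\<forall>i<m. dist_after P x j $ i = (\<Sum>s\<in>S. p s * of_bool (g i = run \<delta> x s j)))" for x j
  proof (induction j)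
    case 0
    have "(\<Sum>s\<in>S. p s * of_bool (g i = s)) = p (g i)" if "i < m" for i
    proof -
      have "(\<Sum>s\<in>S. p s * of_bool (g i = s)) = (\<Sum>s\<in>S. if g i = s then p s else 0)"
        by (intro sum.cong) auto
      then show ?thesis using gS[OF that] fin by simp
    qed
    then show ?case by (simp add: P_def)
  next
    case (Suc j)
    have "dist_after P x (Suc j) $ i = (\<Sum>s\<in>S. p s * of_bool (g i = run \<delta> x s (Suc j)))"
      if i: "i < m" for i
    proof -
      let ?D = "\<lambda>s. \<delta> (Suc j) (x (Suc j)) s"
      have "dist_after P x (Suc j) $ i =
          (\<Sum>k<m. of_bool (g i = ?D (g k)) * dist_after P x j $ k)"
        unfolding dist_after.simps P_transition P_order
        using i Suc[THEN conjunct1]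
        by (auto simp: scalar_prod_def atLeast0LessThan intro!: sum.cong)
      also have "\<dots> = (\<Sum>k<m. of_bool (g i = ?D (g k)) *
          (\<Sum>s\<in>S. p s * of_bool (g k = run \<delta> x s j)))"
        using Suc by (intro sum.cong) auto
      also have "\<dots> = (\<Sum>s\<in>S. \<Sum>k<m. of_bool (g i = ?D (g k)) *
          (p s * of_bool (g k = run \<delta> x s j)))"
        by (subst sum.swap) (simp add: sum_distrib_left)
      \<comment> \<open>Where the second indicator is nonzero, \<open>g k\<close> equals
        \<open>run \<delta> x s j\<close>. Substituting this in the first indicator frees it from
        \<open>k\<close>, so it leaves the inner sum.\<close>
      also have "\<dots> = (\<Sum>s\<in>S. p s * of_bool (g i = ?D (run \<delta> x s j)) *
          (\<Sum>k<m. of_bool (g k = run \<delta> x s j)))"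
        unfolding sum_distrib_left by (intro sum.cong refl) (auto simp: of_bool_def)
      also have "\<dots> = (\<Sum>s\<in>S. p s * of_bool (g i = run \<delta> x s (Suc j)))"
        by (intro sum.cong refl, subst indicator_sum)
          (simp_all add: run_closed[of S \<delta>, OF closed])
      finally show ?thesis .
    qed
    moreover have "dist_after P x (Suc j) \<in> carrier_vec m"
      by (simp add: P_transition mult_mat_vec_def)
    ultimately show ?case by blast
  qed
  have answer_sum: "(\<Sum>i\<in>answer_states P b. dist_after P x n $ i) =
      (\<Sum>s | s \<in> S \<and> out (run \<delta> x s n) = Some b. p s)" for x b
  proof -
    have "answer_states P b = {i. i < m \<and> out (g i) = Some b}"
      by (cases b) (simp_all add: answer_states_def P_def)
    then have "(\<Sum>i\<in>answer_states P b. dist_after P x n $ i) =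
        (\<Sum>i | i < m \<and> out (g i) = Some b. \<Sum>s\<in>S. p s * of_bool (g i = run \<delta> x s n))"
      using dist by (intro sum.cong) auto
    also have "\<dots> = (\<Sum>t | t \<in> S \<and> out t = Some b. \<Sum>s\<in>S. p s * of_bool (t = run \<delta> x s n))"
      by (rule reindex)
    also have "\<dots> = (\<Sum>s\<in>S. \<Sum>t | t \<in> S \<and> out t = Some b. p s * of_bool (t = run \<delta> x s n))"
      by (rule sum.swap)
    also have "\<dots> = (\<Sum>s\<in>S. if out (run \<delta> x s n) = Some b then p s else 0)"
    proof (rule sum.cong[OF refl])
      fix s assume "s \<in> S"
      then have r: "run \<delta> x s n \<in> S"
        using run_closed[of S \<delta>, OF closed] by blast
      have "(\<Sum>t | t \<in> S \<and> out t = Some b. p s * of_bool (t = run \<delta> x s n)) =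
          (\<Sum>t | t \<in> S \<and> out t = Some b. if t = run \<delta> x s n then p s else 0)"
        by (intro sum.cong) auto
      then show "(\<Sum>t | t \<in> S \<and> out t = Some b. p s * of_bool (t = run \<delta> x s n)) =
          (if out (run \<delta> x s n) = Some b then p s else 0)"
        using r fin by simp
    qed
    also have "\<dots> = (\<Sum>s | s \<in> S \<and> out (run \<delta> x s n) = Some b. p s)"
      using fin by (simp add: sum.If_cases Int_def)
    finally show ?thesis .
  qed
  have "is_pobdd n P"
  proof -
    have "prob_vec m (init_dist P)"
      using p_nonneg gS p_sum sum.reindex_bij_betw[OF g, of p]
      by (simp add: prob_vec_def P_def)
    moreover have "column_stochastic m (transition P j b)" for j b
      using indicator_sum closed gS
      by (auto simp: column_stochastic_def prob_vec_def P_def)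
    ultimately show ?thesis
      by (simp add: is_pobdd_def P_def permutes_id)
  qed
  then have "is_lv_pobdd n P"
    by (auto simp: is_lv_pobdd_def P_def)
  then have "lv_computes n \<epsilon> P f"
    using wrong right by (simp add: lv_computes_def answer_sum)
  then show ?thesis
    by (auto simp: P_def m_def)
qed

section \<open>Storing one parity class of the cells\<close>

definition parity_class :: "bool \<Rightarrow> bool list \<Rightarrow> bool list" where
  "parity_class h a = map (\<lambda>i. a ! (2 * i + of_bool h)) [0..<length a div 2]"

lemma length_ShiftX: "a \<noteq> [] \<Longrightarrow> length (ShiftX a b) = length a"
  by (simp add: ShiftX_def)

lemma nth_ShiftX:
  "i < length a \<Longrightarrow> ShiftX a b ! i = (if Suc i < length a then a ! Suc i else a ! 0 \<noteq> b)"
  by (cases a) (auto simp: ShiftX_def nth_append)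

lemma length_parity_class [simp]: "length (parity_class h a) = length a div 2"
  by (simp add: parity_class_def)

lemma nth_parity_class:
  "i < length a div 2 \<Longrightarrow> parity_class h a ! i = a ! (2 * i + of_bool h)"
  by (simp add: parity_class_def)

text \<open>A shift moves cell \<open>i + 1\<close> to \<open>i\<close>, so an odd class becomes the
  even one with contents and order unchanged. Cell 0 heads the even class and re-enters, xored with
  \<open>b\<close>, at the last position, which is odd because the length is even. The even class
  thus undergoes a \<open>ShiftX\<close> of its own.\<close>

lemma parity_class_ShiftX:
  assumes "even (length a)" "a \<noteq> []"
  shows "parity_class (\<not> h) (ShiftX a b) =
    (if h then parity_class h a else ShiftX (parity_class h a) b)"
proof (rule nth_equalityI)
  obtain l where l: "length a = 2 * l" using assms by (elim evenE)
  have "l > 0" using assms l by (cases l) auto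
  then have ne: "parity_class h a \<noteq> []"
    using l length_parity_class[of h a] by fastforce
  show "length (parity_class (\<not> h) (ShiftX a b)) =
      length (if h then parity_class h a else ShiftX (parity_class h a) b)"
    using assms ne by (cases h) (simp_all add: length_ShiftX)
  fix i assume "i < length (parity_class (\<not> h) (ShiftX a b))"
  then have "i < l" using assms l by (simp add: length_ShiftX)
  then show "parity_class (\<not> h) (ShiftX a b) ! i =
      (if h then parity_class h a else ShiftX (parity_class h a) b) ! i"
    using assms l \<open>l > 0\<close> by (auto simp: nth_parity_class length_ShiftX nth_ShiftX)
qed

section \<open>The program for Shuffled Storage Access\<close>

lemma marked_indices_Suc:
  "marked_indices (2 * Suc i) c x =
    marked_indices (2 * i) c x @ (if x (Suc (2 * i)) = c then [2 * Suc i] else [])"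
  by (simp add: marked_indices_def)

lemma shift_in_Nil: "shift_in t [] x = replicate t False"
  by (simp add: shift_in_def)

lemma shift_in_snoc: "shift_in t (js @ [j]) x = ShiftX (shift_in t js x) (x j)"
  by (simp add: shift_in_def)

lemma length_shift_in: "0 < t \<Longrightarrow> length (shift_in t js x) = t"
proof (induction js rule: rev_induct)
  case (snoc j js)
  then have "shift_in t js x \<noteq> []" by auto
  then show ?case using snoc by (simp add: shift_in_snoc length_ShiftX)
qed (simp add: shift_in_Nil)

lemma binary_address_less: "binary_address bs < 2 ^ length bs"
  using horner_sum_of_bool_2_less[of "rev bs"] by (simp add: binary_address_def)

text \<open>A state \<open>(c, h, q, \<beta>)\<close> holds the last selector bit \<open>c\<close> and
  \<open>q = parity_class h \<alpha>\<close>.\<close>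

type_synonym ssa_state = "bool \<times> bool \<times> bool list \<times> bool list"

definition ssa_states :: "nat \<Rightarrow> ssa_state set" where
  "ssa_states d = UNIV \<times> UNIV \<times> {q. length q = 2 ^ d div 2} \<times> {\<beta>. length \<beta> = d}"

definition ssa_init :: "nat \<Rightarrow> bool \<Rightarrow> ssa_state" where
  "ssa_init d h = (False, h, replicate (2 ^ d div 2) False, replicate d False)"

text \<open>Odd steps read a selector, even steps the data bit it governs. The flag \<open>h\<close>
  flips with every shift of \<alpha>, even when the queue itself stays put.\<close>

definition ssa_step :: "nat \<Rightarrow> bool \<Rightarrow> ssa_state \<Rightarrow> ssa_state" where
  "ssa_step j b = (\<lambda>(c, h, q, \<beta>).
    if odd j then (b, h, q, \<beta>)
    else if c then (c, h, q, ShiftX \<beta> b)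
    else (c, \<not> h, if h then q else ShiftX q b, \<beta>))"

text \<open>Cell \<open>a\<close> of \<alpha> lies in the class of the parity of \<open>a\<close>,
  at queue position \<open>a div 2\<close>.\<close>

definition ssa_output :: "ssa_state \<Rightarrow> bool option" where
  "ssa_output = (\<lambda>(c, h, q, \<beta>). let a = binary_address \<beta> in
    if odd a = h then Some (q ! (a div 2)) else None)"

lemma finite_ssa_states: "finite (ssa_states d)"
  and card_ssa_states: "card (ssa_states d) = 2 ^ (2 ^ d div 2 + d + 2)"
proof -
  have lists: "finite {q :: bool list. length q = k}" "card {q :: bool list. length q = k} = 2 ^ k"
    for k
    using finite_lists_length_eq[of "UNIV :: bool set" k]
      card_lists_length_eq[of "UNIV :: bool set" k] by simp_all
  show "finite (ssa_states d)"
    unfolding ssa_states_def using lists by (intro finite_cartesian_product) auto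
  show "card (ssa_states d) = 2 ^ (2 ^ d div 2 + d + 2)"
    by (simp add: ssa_states_def card_cartesian_product lists power_add)
qed

lemma ssa_init_in_states: "ssa_init d h \<in> ssa_states d"
  by (simp add: ssa_init_def ssa_states_def)

lemma ssa_step_closed:
  assumes "1 \<le> d" "s \<in> ssa_states d"
  shows "ssa_step j b s \<in> ssa_states d"
proof -
  \<comment> \<open>\<open>ShiftX\<close> keeps the length only of nonempty lists;
    \<open>1 \<le> d\<close> makes both the queue and the address register nonempty.\<close>
  have "(0::nat) < 2 ^ d div 2" using assms(1) by (cases d) auto
  moreover obtain c h q \<beta> where "s = (c, h, q, \<beta>)" "length q = 2 ^ d div 2" "length \<beta> = d"
    using assms(2) by (auto simp: ssa_states_def)
  moreover from calculation assms(1) have "q \<noteq> []" "\<beta> \<noteq> []" by auto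
  ultimately show ?thesis
    by (auto simp: ssa_states_def ssa_step_def length_ShiftX)
qed

text \<open>The invariant is stated after complete pairs of a selector and its data bit. There the
  value of \<open>c\<close> is irrelevant, since the next step overwrites it.\<close>

lemma run_ssa:
  assumes "1 \<le> d"
  shows "\<exists>c. run ssa_step x (ssa_init d h) (2 * i) =
    (let h' = (h \<noteq> odd (length (marked_indices (2 * i) False x)))
     in (c, h', parity_class h' (shift_in (2 ^ d) (marked_indices (2 * i) False x) x),
         shift_in d (marked_indices (2 * i) True x) x))"
proof (induction i)
  case 0
  have "parity_class h (replicate (2 ^ d) False) = replicate (2 ^ d div 2) False"
  proof (rule nth_equalityI)
    fix i assume "i < length (parity_class h (replicate (2 ^ d) False))"
    then have "i < 2 ^ d div 2" by simp
    moreover from this have "2 * i + of_bool h < 2 ^ d" by (cases h) auto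
    ultimately show "parity_class h (replicate (2 ^ d) False) ! i =
        replicate (2 ^ d div 2) False ! i"
      by (simp add: nth_parity_class)
  qed simp
  then show ?case
    by (intro exI[of _ False]) (simp add: marked_indices_def shift_in_Nil ssa_init_def)
next
  case (Suc i)
  let ?\<alpha> = "shift_in (2 ^ d) (marked_indices (2 * i) False x) x"
  have len: "length ?\<alpha> = 2 ^ d" by (simp add: length_shift_in)
  then have "even (length ?\<alpha>)" "?\<alpha> \<noteq> []" using assms by auto
  note shift = parity_class_ShiftX[OF this]
  have two: "2 * Suc i = Suc (Suc (2 * i))" by simp
  let ?h = "h \<noteq> odd (length (marked_indices (2 * i) False x))"
  let ?\<beta> = "shift_in d (marked_indices (2 * i) True x) x"
  from Suc obtain c where
    c: "run ssa_step x (ssa_init d h) (2 * i) = (c, ?h, parity_class ?h ?\<alpha>, ?\<beta>)"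
    unfolding Let_def by blast
  have step: "run ssa_step x (ssa_init d h) (2 * Suc i) = ssa_step (2 * Suc i) (x (2 * Suc i))
      (x (Suc (2 * i)), ?h, parity_class ?h ?\<alpha>, ?\<beta>)"
    unfolding two run.simps c by (simp add: ssa_step_def)
  show ?case
  proof (cases "x (Suc (2 * i))")
    case True
    then show ?thesis
      unfolding step marked_indices_Suc by (auto simp: ssa_step_def shift_in_snoc Let_def)
  next
    case False
    then show ?thesis
      unfolding step marked_indices_Suc
      using shift[of ?h "x (2 * Suc i)"]
      by (auto simp: ssa_step_def shift_in_snoc Let_def)
  qed
qed

text \<open>The value compared with \<open>h\<close> depends on the input alone, so exactly one
  outcome of the coin yields an answer, and that answer is correct.\<close>

lemma ssa_output_run:
  assumes "1 \<le> d" "even n"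
  shows "ssa_output (run ssa_step x (ssa_init d h) n) =
    (if h = (odd (binary_address (shift_in d (marked_indices n True x) x)) \<noteq>
             odd (length (marked_indices n False x)))
     then Some (SSA d n x) else None)"
proof -
  let ?\<alpha> = "shift_in (2 ^ d) (marked_indices n False x) x"
  let ?\<beta> = "shift_in d (marked_indices n True x) x"
  let ?a = "binary_address ?\<beta>"
  define h' where "h' = (h \<noteq> odd (length (marked_indices n False x)))"
  obtain c where c: "run ssa_step x (ssa_init d h) n = (c, h', parity_class h' ?\<alpha>, ?\<beta>)"
    using run_ssa[OF assms(1), of x h "n div 2"] assms(2) unfolding Let_def h'_def by auto
  have "?a < 2 ^ d"
    using binary_address_less[of ?\<beta>] assms(1) by (simp add: length_shift_in)
  then have "?a div 2 < 2 ^ d div 2"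
    using assms(1) by (cases d) auto
  \<comment> \<open>Division with remainder:
    \<open>2 * (?a div 2) + of_bool (odd ?a) = ?a\<close>.\<close>
  then have "parity_class h' ?\<alpha> ! (?a div 2) = ?\<alpha> ! ?a" if "odd ?a = h'"
    using that[symmetric] by (simp add: nth_parity_class length_shift_in)
  then show ?thesis
    unfolding c by (auto simp: ssa_output_def SSA_def Let_def h'_def)
qed

lemma lv_computes_SSA:
  assumes "1 \<le> d" "even n"
  shows "\<exists>P. lv_computes n (1 / 2) P (SSA d n) \<and> width P = 2 ^ (2 ^ d div 2 + d + 2)"
proof -
  \<comment> \<open>The fair coin: mass 1/2 on each of the two initial states, which are distinct
    because they differ in \<open>h\<close>.\<close>
  define p :: "ssa_state \<Rightarrow> real"
    where "p s = (if s \<in> range (ssa_init d) then 1 / 2 else 0)" for s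
  have sum_p: "(\<Sum>s | s \<in> ssa_states d \<and> Q s. p s) =
      (\<Sum>h\<in>UNIV. if Q (ssa_init d h) then 1 / 2 else 0)" for Q
  proof -
    have "(\<Sum>s | s \<in> ssa_states d \<and> Q s. p s) = (\<Sum>s\<in>range (ssa_init d). if Q s then 1 / 2 else 0)"
      using finite_ssa_states[of d] ssa_init_in_states[of d]
      by (intro sum.mono_neutral_cong) (auto simp: p_def)
    also have "\<dots> = (\<Sum>h\<in>UNIV. if Q (ssa_init d h) then 1 / 2 else 0)"
      by (subst sum.reindex) (auto simp: inj_def ssa_init_def)
    finally show ?thesis .
  qed
  have "\<exists>P. lv_computes n (1 / 2) P (SSA d n) \<and> width P = card (ssa_states d)"
  proof (rule lv_computes_of_deterministic_transitions
      [where \<delta> = ssa_step and p = p and out = ssa_output])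
    show "sum p (ssa_states d) = 1"
      using sum_p[of "\<lambda>_. True"] by simp
    show "0 \<le> p s" for s
      by (simp add: p_def)
    show "(\<Sum>s | s \<in> ssa_states d \<and> ssa_output (run ssa_step x s n) = Some (\<not> SSA d n x). p s) = 0"
      for x
      unfolding sum_p ssa_output_run[OF assms] by (rule sum.neutral) auto
    show "1 - 1 / 2 \<le>
        (\<Sum>s | s \<in> ssa_states d \<and> ssa_output (run ssa_step x s n) = Some (SSA d n x). p s)" for x
      unfolding sum_p ssa_output_run[OF assms] by (simp add: UNIV_bool)
  qed (rule finite_ssa_states, rule ssa_step_closed[OF assms(1)])
  then show ?thesis by (simp add: card_ssa_states)
qed

theorem theorem6:
  fixes d n :: nat
  assumes "1 \<le> d" and "even n" and "2 ^ d + d = n div 2"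
  shows "(\<exists>P. lv_computes n (1 / 2) P (SSA d n) \<and> width P \<le> 2 ^ (2 ^ d div 2 + d + 3)) \<and>
    LV_OBDD n (1 / 2) (SSA d n) \<le> enat (2 ^ (2 ^ d div 2 + d + 3))"
proof -
  obtain P where P: "lv_computes n (1 / 2) P (SSA d n)" "width P = 2 ^ (2 ^ d div 2 + d + 2)"
    using lv_computes_SSA[OF assms(1,2)] by blast
  \<comment> \<open>Besides the queue and the address register a state has only the two bits
    \<open>c\<close> and \<open>h\<close>, so the exponent stays one below the bound.\<close>
  have w: "width P \<le> 2 ^ (2 ^ d div 2 + d + 3)"
    unfolding P(2) by (rule power_increasing) auto
  have "LV_OBDD n (1 / 2) (SSA d n) \<le> enat (width P)"
    unfolding LV_OBDD_def using P(1) by (intro Inf_lower) auto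
  also have "\<dots> \<le> enat (2 ^ (2 ^ d div 2 + d + 3))"
    using w by simp
  finally show ?thesis
    using P(1) w by blast
qed

end
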